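(* Let $A$ and $B$ be finite subsets of a group $G$ such that $|A|\ge 2$ and $|B|\ge 2$. (i) If $\mathcal{E}$ is a set of pairwise-disjoint, single-product subsets of $A\times B$, then $$\sum_{E\in\mathcal{E}} (|E|-2) \;\le\; \theta\alpha_3(G)\cdot(|A|-2)\cdot(|B|-2).$$ (ii) If $\mathcal{C}$ is a set of pairwise-disjoint, single-quotient subsets of $A\times B$, then $$\sum_{C\in\mathcal{C}} (|C|-2) \;\le\; \theta\alpha_3(G)\cdot(|A|-2)\cdot(|B|-2).$$
   Context: A subset $C$ of $A\times B$ is a single-product subset if $|\{ab \mid (a,b)\in C\}| = 1$, and a single-quotient subset if $|\{ab^{-1} \mid (a,b)\in C\}| = 1$. For a set $S$, $|S|$ is its cardinal if $S$ is finite and $\infty$ otherwise. Define $\alpha_3(G) := \inf\{|L| : L \text{ is a subgroup of } G \text{ and } |L|\ge 3\}$, where the infimum of the empty set is $\infty$ (so $\alpha_3(G)$ is $\infty$, $4$, or an odd prime). Define $\theta:[3,\infty]\to[1,3]$ by $\theta(x) = \frac{x}{x-2}$ with $\theta(\infty)=1$, and write $\theta\alpha_3(G) := \theta(\alpha_3(G))$. *)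

theory Defs
  imports "HOL-Algebra.Group" "HOL-Library.Extended_Real" "HOL-Library.Disjoint_Sets"
begin

definition single_product_subset ::
  "('a, 'm) monoid_scheme \<Rightarrow> 'a set \<Rightarrow> 'a set \<Rightarrow> ('a \<times> 'a) set \<Rightarrow> bool" where
  "single_product_subset G A B C \<longleftrightarrow>
     C \<subseteq> A \<times> B \<and> card {a \<otimes>\<^bsub>G\<^esub> b | a b. (a, b) \<in> C} = 1"

definition single_quotient_subset ::
  "('a, 'm) monoid_scheme \<Rightarrow> 'a set \<Rightarrow> 'a set \<Rightarrow> ('a \<times> 'a) set \<Rightarrow> bool" where
  "single_quotient_subset G A B C \<longleftrightarrow>
     C \<subseteq> A \<times> B \<and> card {a \<otimes>\<^bsub>G\<^esub> inv\<^bsub>G\<^esub> b | a b. (a, b) \<in> C} = 1"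

definition ext_card :: "'a set \<Rightarrow> enat" where
  "ext_card S = (if finite S then enat (card S) else \<infinity>)"

(* The infimum is taken in enat, where the infimum of the empty set is infinity. *)
definition alpha3 :: "('a, 'm) monoid_scheme \<Rightarrow> enat" where
  "alpha3 G = Inf {ext_card L | L. subgroup L G \<and> 3 \<le> ext_card L}"

(* Only the values on the interval [3, infinity] are meaningful. *)
definition theta :: "ereal \<Rightarrow> real" where
  "theta x = (if x = \<infinity> then 1 else real_of_ereal x / (real_of_ereal x - 2))"

end

theory Submission
  imports Defs
begin

text \<open>
  Let r(x) be the number of ways to write x = a b with a in A and b in B, and let S(A, B) be the
  sum of max (r(x) - 2) 0 over all x. Grouping the members of a family by their common product
  shows that S(A, B) bounds the sum in the first claim (\<open>sum_card_minus_2_le_excess\<close>); replacing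
  B by the set of its inverses turns the second claim into the first. So the task is to show
  S(A, B) \<le> \<theta> (|A| - 2) (|B| - 2), where \<theta> = p / (p - 2) and p is the least order of a subgroup
  with at least three elements.

  Two bounds on S are cheap. Since r \<le> |A|, we have S(A, B) \<le> (|A| - 2) |B|, which is good
  enough if |A| = 2 or |B| \<ge> p (\<open>product_excess_le\<close>). And since 6 (r - 2) \<le> r (r - 1), the
  number of coincidences a b = a' b' with a \<noteq> a' bounds 6 S, which is good enough if distinct left
  translates of B share at most one point and 3 \<le> |A| \<le> |B| (\<open>six_product_excess_le\<close>).

  An isoperimetric argument shows that nothing lies between these two extremes. Fix A and
  consider F(B) = S(A, B) - \<theta> (|A| - 2) (|B| - 2). As max (r - 2) 0 is a convex function of r,
  F is supermodular in B (\<open>excess_supermodular\<close>), and it is invariant under right translation of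
  B. Suppose that F takes a positive value, and let B be a set of least size among those with at
  least two elements on which F is maximal. If a translate B h \<noteq> B shared two points with B, then
  F(B \<inter> B h) < F(B) by minimality and F(B \<union> B h) \<le> F(B) by maximality, against supermodularity.
  So each translate B h either equals B or meets it in at most one point. Let H be the
  group of all h with B h = B; then |H| \<le> |B|. If |H| \<ge> 3 then |B| \<ge> p and the first cheap
  bound applies. If |H| \<le> 2 then the translates g B with g \<noteq> 1 meet B in at most |H| points.
  Moreover |B| \<ge> 2 |H|, which makes up for the weaker estimate in the case |H| = 2, and the second
  cheap bound applies. The inequality |A| \<le> |B| that it needs comes from induction on |A|,
  because the inverses exchange the roles of the two factors (\<open>product_excess_inv\<close>). This is
  \<open>product_excess_bound\<close>.
\<close>

section \<open>Excess of a map over two-element fibres\<close>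

text \<open>Subtraction on natural numbers truncates, so fibres with at most two elements do not
  contribute.\<close>

definition excess :: "('p \<Rightarrow> 'x) \<Rightarrow> 'p set \<Rightarrow> nat" where
  "excess \<phi> P = (\<Sum>x\<in>\<phi> ` P. card {q \<in> P. \<phi> q = x} - 2)"

lemma excess_eq_sum_superset:
  assumes "finite Z" "\<phi> ` P \<subseteq> Z"
  shows "excess \<phi> P = (\<Sum>x\<in>Z. card {q \<in> P. \<phi> q = x} - 2)"
  unfolding excess_def
proof (rule sum.mono_neutral_left[OF assms])
  show "\<forall>x\<in>Z - \<phi> ` P. card {q \<in> P. \<phi> q = x} - 2 = 0"
  proof
    fix x assume "x \<in> Z - \<phi> ` P"
    then have "{q \<in> P. \<phi> q = x} = {}" by auto
    then show "card {q \<in> P. \<phi> q = x} - 2 = 0" by (metis card.empty diff_0_eq_0)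
  qed
qed

text \<open>The excess depends only on the sizes of the fibres. This gives the invariance of the product
  excess under translation and under inversion, and the passage from quotients to products.\<close>

lemma excess_reindex:
  assumes bij: "bij_betw f Q P" and inj: "inj_on g (\<psi> ` Q)"
    and comm: "\<And>q. q \<in> Q \<Longrightarrow> \<phi> (f q) = g (\<psi> q)"
  shows "excess \<phi> P = excess \<psi> Q"
proof -
  have P: "P = f ` Q" and injf: "inj_on f Q"
    using bij by (auto simp: bij_betw_def)
  have img: "\<phi> ` P = g ` \<psi> ` Q"
    unfolding P image_image using comm by (rule image_cong[OF refl])
  have "card {q \<in> P. \<phi> q = g x} = card {q \<in> Q. \<psi> q = x}" if x: "x \<in> \<psi> ` Q" for x
  proof -
    have "\<phi> (f q) = g x \<longleftrightarrow> \<psi> q = x" if "q \<in> Q" for q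
      using comm[OF that] inj x that by (metis image_eqI inj_onD)
    then have "{q \<in> P. \<phi> q = g x} = f ` {q \<in> Q. \<psi> q = x}"
      unfolding P by blast
    then show ?thesis
      using injf by (simp add: card_image inj_on_def)
  qed
  then show ?thesis
    unfolding excess_def img by (simp add: sum.reindex[OF inj])
qed

text \<open>On each fibre this is the inequality f(i) + f(u) \<ge> f(s) + f(t) for the convex function
  f(r) = max (r - 2) 0, where s + t = i + u and s, t lie between i and u.\<close>

lemma excess_supermodular:
  assumes "finite P" "finite Q"
  shows "excess \<phi> P + excess \<phi> Q \<le> excess \<phi> (P \<inter> Q) + excess \<phi> (P \<union> Q)"
proof -
  define Z where "Z = \<phi> ` (P \<union> Q)"
  define F where "F R x = {q \<in> R. \<phi> q = x}" for R x
  have Z: "finite Z" using assms by (simp add: Z_def)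
  have eq: "excess \<phi> R = (\<Sum>x\<in>Z. card (F R x) - 2)" if "R \<subseteq> P \<union> Q" for R
    unfolding F_def using that by (intro excess_eq_sum_superset[OF Z]) (auto simp: Z_def)
  have pt: "(card (F P x) - 2) + (card (F Q x) - 2)
      \<le> (card (F (P \<inter> Q) x) - 2) + (card (F (P \<union> Q) x) - 2)" for x
  proof -
    have fin: "finite (F P x)" "finite (F Q x)" using assms by (auto simp: F_def)
    have F_Int_Un: "F (P \<inter> Q) x = F P x \<inter> F Q x" "F (P \<union> Q) x = F P x \<union> F Q x"
      by (auto simp: F_def)
    have "card (F P x) + card (F Q x) = card (F P x \<union> F Q x) + card (F P x \<inter> F Q x)"
      using card_Un_Int[OF fin] .
    moreover have "card (F P x) \<le> card (F P x \<union> F Q x)" "card (F Q x) \<le> card (F P x \<union> F Q x)"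
      using fin by (auto intro: card_mono)
    moreover have "card (F P x \<inter> F Q x) \<le> card (F P x)" "card (F P x \<inter> F Q x) \<le> card (F Q x)"
      using fin by (auto intro: card_mono)
    ultimately show ?thesis unfolding F_Int_Un by linarith
  qed
  show ?thesis
    using sum_mono[of Z "\<lambda>x. (card (F P x) - 2) + (card (F Q x) - 2)", OF pt]
    by (simp add: eq sum.distrib le_supI1)
qed

text \<open>A fibre of size r \<le> n satisfies n (r - 2) \<le> (n - 2) r, and the sizes of the fibres add up to
  the size of the domain.\<close>

lemma excess_le_of_fibre_card_le:
  assumes fin: "finite P" and n: "n \<ge> 2"
    and fibre: "\<And>x. card {q \<in> P. \<phi> q = x} \<le> n"
  shows "n * excess \<phi> P \<le> (n - 2) * card P"
proof -
  have "card P = (\<Sum>x\<in>\<phi> ` P. card {q \<in> P. \<phi> q = x})"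
    using sum.image_gen[OF fin, of "\<lambda>_. 1::nat" \<phi>] by simp
  moreover have "n * (card {q \<in> P. \<phi> q = x} - 2) \<le> (n - 2) * card {q \<in> P. \<phi> q = x}" for x
    using fibre[of x] n by (simp add: diff_mult_distrib diff_mult_distrib2)
  ultimately show ?thesis
    unfolding excess_def by (simp add: sum_distrib_left sum_mono)
qed

text \<open>A fibre of size r contains r (r - 1) ordered pairs of distinct elements.\<close>

lemma six_excess_le_collisions:
  assumes fin: "finite P"
  shows "6 * excess \<phi> P \<le> card {(q, q'). q \<in> P \<and> q' \<in> P \<and> \<phi> q = \<phi> q' \<and> q \<noteq> q'}"
proof -
  define F where "F x = {q \<in> P. \<phi> q = x}" for x
  define C where "C x = F x \<times> F x - (\<lambda>q. (q, q)) ` F x" for x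
  have finF: "finite (F x)" for x using fin by (simp add: F_def)
  have cardO: "card (C x) = card (F x) * card (F x) - card (F x)" for x
  proof -
    have "card ((\<lambda>q. (q, q)) ` F x) = card (F x)"
      by (intro card_image inj_onI) simp
    then show ?thesis
      unfolding C_def using finF by (subst card_Diff_subset) (auto simp: card_cartesian_product)
  qed
  \<comment> \<open>For r \<ge> 2 the difference of the two sides is (r - 3) (r - 4), which is nonnegative at
    every integer r.\<close>
  have pt: "6 * (r - 2) \<le> r * r - r" for r :: nat
  proof (cases "r \<le> 4")
    case True
    then have "r \<in> {0,1,2,3,4}" by auto
    then show ?thesis by auto
  next
    case False
    then obtain k where "r = 5 + k" using le_Suc_ex[of 5 r] by auto
    then show ?thesis by (simp add: algebra_simps)
  qed
  have "6 * excess \<phi> P \<le> (\<Sum>x\<in>\<phi> ` P. card (C x))"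
    unfolding excess_def sum_distrib_left cardO F_def using pt by (intro sum_mono)
  also have "\<dots> = card (\<Union>x\<in>\<phi> ` P. C x)"
    using fin finF by (subst card_UN_disjoint) (auto simp: C_def F_def)
  also have "(\<Union>x\<in>\<phi> ` P. C x) = {(q, q'). q \<in> P \<and> q' \<in> P \<and> \<phi> q = \<phi> q' \<and> q \<noteq> q'}"
    by (auto simp: C_def F_def)
  finally show ?thesis .
qed

text \<open>A block of the family lies in a single fibre. If k \<ge> 1 blocks lie in a fibre of size r, they
  contribute at most r - 2 k \<le> r - 2, so it is best to use the whole fibre as one block, and to
  use no block in fibres with fewer than three elements.\<close>

lemma sum_card_minus_2_le_excess:
  fixes \<E> :: "'p set set"
  assumes fin: "finite P" and dis: "disjoint \<E>"
    and sub: "\<And>E. E \<in> \<E> \<Longrightarrow> E \<subseteq> P"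
    and const: "\<And>E. E \<in> \<E> \<Longrightarrow> \<exists>x. \<phi> ` E = {x}"
  shows "(\<Sum>E\<in>\<E>. real (card E) - 2) \<le> real (excess \<phi> P)"
proof -
  have "\<E> \<subseteq> Pow P" using sub by auto
  then have finE: "finite \<E>" using fin by (meson finite_Pow_iff finite_subset)
  obtain v where v: "\<And>E. E \<in> \<E> \<Longrightarrow> \<phi> ` E = {v E}" using const by metis
  have vP: "v ` \<E> \<subseteq> \<phi> ` P"
  proof
    fix x assume "x \<in> v ` \<E>"
    then obtain E where "E \<in> \<E>" "x \<in> \<phi> ` E" using v by blast
    then show "x \<in> \<phi> ` P" using sub by blast
  qed
  have pt: "(\<Sum>E\<in>{E \<in> \<E>. v E = x}. real (card E) - 2) \<le> real (card {q \<in> P. \<phi> q = x} - 2)"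
    if "x \<in> v ` \<E>" for x
  proof -
    let ?D = "{E \<in> \<E>. v E = x}"
    have D: "finite ?D" "?D \<noteq> {}" using finE that by auto
    then have one: "1 \<le> card ?D" by (metis One_nat_def Suc_leI card_gt_0_iff)
    have "(\<Sum>E\<in>?D. card E) = card (\<Union> ?D)"
    proof (rule card_Union_disjoint[symmetric])
      show "pairwise disjnt ?D"
        using dis by (auto simp: pairwise_def disjnt_def disjoint_def)
      show "\<And>E. E \<in> ?D \<Longrightarrow> finite E" using sub fin finite_subset by blast
    qed
    also have "\<dots> \<le> card {q \<in> P. \<phi> q = x}"
      using fin sub v by (intro card_mono) (simp, blast)
    finally have "real (\<Sum>E\<in>?D. card E) \<le> real (card {q \<in> P. \<phi> q = x})"
      by (simp only: of_nat_le_iff)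
    then have "(\<Sum>E\<in>?D. real (card E) - 2) \<le> real (card {q \<in> P. \<phi> q = x}) - 2 * real (card ?D)"
      by (simp add: sum_subtractf)
    also have "\<dots> \<le> real (card {q \<in> P. \<phi> q = x} - 2)"
      using one by linarith
    finally show ?thesis .
  qed
  have "(\<Sum>E\<in>\<E>. real (card E) - 2) = (\<Sum>x\<in>v ` \<E>. \<Sum>E\<in>{E \<in> \<E>. v E = x}. real (card E) - 2)"
    using sum.image_gen[OF finE] by blast
  also have "\<dots> \<le> (\<Sum>x\<in>v ` \<E>. real (card {q \<in> P. \<phi> q = x} - 2))"
    by (intro sum_mono pt)
  also have "\<dots> \<le> (\<Sum>x\<in>\<phi> ` P. real (card {q \<in> P. \<phi> q = x} - 2))"
    using fin vP by (intro sum_mono2) auto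
  finally show ?thesis by (simp add: excess_def)
qed

text \<open>The arithmetic that closes the main argument: here n and m are the sizes of the two factors
  and k is the order of a stabilizer. It is sharp for n = m = 3, k = 1 and for n = m = 4, k = 2.\<close>

lemma few_collisions_estimate:
  fixes n m k :: nat
  assumes "n \<ge> 3" "m \<ge> n" "m \<ge> 2 * k" "k \<le> 2"
  shows "n * (n - 1) * k \<le> 6 * ((n - 2) * (m - 2))"
proof -
  obtain i where i: "n = i + 3" using assms(1) by (metis le_add_diff_inverse2)
  obtain j where j: "m = n + j" using assms(2) by (metis le_add_diff_inverse)
  show ?thesis
  proof (cases "k = 2 \<and> i = 0")
    case True
    then show ?thesis using assms i by simp
  next
    case False
    show ?thesis
    proof (cases "k = 2")
      case True
      with False obtain l where "i = Suc l" using not0_implies_Suc by blast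
      then show ?thesis using True by (simp add: i j algebra_simps)
    next
      case False
      then have "k \<le> 1" using assms by simp
      then have "n * (n - 1) * k \<le> n * (n - 1) * 1" by (intro mult_le_mono) auto
      also have "\<dots> \<le> 6 * ((n - 2) * (m - 2))" by (simp add: i j algebra_simps)
      finally show ?thesis .
    qed
  qed
qed

section \<open>The excess of a product set\<close>

context group
begin

abbreviation product_excess :: "'a set \<Rightarrow> 'a set \<Rightarrow> nat" where
  "product_excess A B \<equiv> excess (\<lambda>(a, b). a \<otimes> b) (A \<times> B)"

lemma inv_image_set:
  assumes "A \<subseteq> carrier G"
  shows "m_inv G ` A \<subseteq> carrier G" "card (m_inv G ` A) = card A" "finite A \<Longrightarrow> finite (m_inv G ` A)"
  using assms by (auto intro!: card_image inj_onI) (metis inv_inv subsetD)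

lemma product_excess_inv:
  assumes "A \<subseteq> carrier G" "B \<subseteq> carrier G"
  shows "product_excess (m_inv G ` B) (m_inv G ` A) = product_excess A B"
proof (rule excess_reindex)
  show "bij_betw (\<lambda>(a, b). (inv b, inv a)) (A \<times> B) (m_inv G ` B \<times> m_inv G ` A)"
    using assms by (auto simp: bij_betw_def inj_on_def image_iff) (metis inv_inv subsetD)+
  show "inj_on (m_inv G) ((\<lambda>(a, b). a \<otimes> b) ` (A \<times> B))"
    using assms by (intro inj_onI) (auto, metis inv_inv m_closed subsetD)
qed (use assms in \<open>auto simp: inv_mult_group subset_iff\<close>)

lemma product_excess_translate:
  assumes "A \<subseteq> carrier G" "B \<subseteq> carrier G" "h \<in> carrier G"
  shows "product_excess A ((\<lambda>b. b \<otimes> h) ` B) = product_excess A B"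
proof (rule excess_reindex)
  show "bij_betw (\<lambda>(a, b). (a, b \<otimes> h)) (A \<times> B) (A \<times> (\<lambda>b. b \<otimes> h) ` B)"
    using assms by (auto simp: bij_betw_def inj_on_def image_iff subset_iff)
  show "inj_on (\<lambda>x. x \<otimes> h) ((\<lambda>(a, b). a \<otimes> b) ` (A \<times> B))"
    using assms by (auto simp: inj_on_def subset_iff)
qed (use assms in \<open>auto simp: m_assoc subset_iff\<close>)

text \<open>In a factorization x = a b the factor a determines b, so no fibre is larger than A.\<close>

lemma product_excess_le:
  assumes "A \<subseteq> carrier G" "B \<subseteq> carrier G" "finite A" "finite B" "card A \<ge> 2"
  shows "product_excess A B \<le> (card A - 2) * card B"
proof -
  have "card {q \<in> A \<times> B. (\<lambda>(a, b). a \<otimes> b) q = x} \<le> card A" for x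
  proof (rule card_inj_on_le)
    show "inj_on fst {q \<in> A \<times> B. (\<lambda>(a, b). a \<otimes> b) q = x}"
      using assms by (auto simp: inj_on_def subset_iff)
  qed (use assms in auto)
  then have "card A * product_excess A B \<le> (card A - 2) * card (A \<times> B)"
    using assms by (intro excess_le_of_fibre_card_le) auto
  then have "card A * product_excess A B \<le> card A * ((card A - 2) * card B)"
    by (simp add: card_cartesian_product mult_ac)
  then show ?thesis using assms by simp
qed

text \<open>A collision a b = a' b' with a \<noteq> a' is determined by a, a' and b, and then b lies in B
  together with its left translate by the element inv a' a \<noteq> 1.\<close>

lemma six_product_excess_le:
  assumes "A \<subseteq> carrier G" "B \<subseteq> carrier G" "finite A" "finite B"
    and overlap: "\<And>g. g \<in> carrier G \<Longrightarrow> g \<noteq> \<one> \<Longrightarrow> card {b \<in> B. g \<otimes> b \<in> B} \<le> k"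
  shows "6 * product_excess A B \<le> card A * (card A - 1) * k"
proof -
  let ?C = "{(q, q'). q \<in> A \<times> B \<and> q' \<in> A \<times> B \<and>
      (\<lambda>(a, b). a \<otimes> b) q = (\<lambda>(a, b). a \<otimes> b) q' \<and> q \<noteq> q'}"
  let ?D = "SIGMA a : A. SIGMA a' : A - {a}. {b \<in> B. (inv a' \<otimes> a) \<otimes> b \<in> B}"
  have "card ?C \<le> card ?D"
  proof (rule card_inj_on_le)
    show "inj_on (\<lambda>((a, b), (a', b')). (a, a', b)) ?C"
      using assms(1,2) by (auto simp: inj_on_def subset_iff)
    show "(\<lambda>((a, b), (a', b')). (a, a', b)) ` ?C \<subseteq> ?D"
    proof (clarsimp, intro conjI)
      fix a b a' b'
      assume *: "a \<in> A" "b \<in> B" "a' \<in> A" "b' \<in> B" "a \<otimes> b = a' \<otimes> b'" "a = a' \<longrightarrow> b \<noteq> b'"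
      then have c: "a \<in> carrier G" "b \<in> carrier G" "a' \<in> carrier G" "b' \<in> carrier G"
        using assms by auto
      then show "a' \<noteq> a" using * by auto
      have "inv a' \<otimes> a \<otimes> b = b'"
        using c *(5) by (simp add: m_assoc inv_solve_left')
      then show "inv a' \<otimes> a \<otimes> b \<in> B" using * by simp
    qed
    show "finite ?D" using assms by auto
  qed
  also have "card ?D = (\<Sum>a\<in>A. \<Sum>a'\<in>A - {a}. card {b \<in> B. (inv a' \<otimes> a) \<otimes> b \<in> B})"
    using assms by simp
  also have "\<dots> \<le> (\<Sum>a\<in>A. \<Sum>a'\<in>A - {a}. k)"
  proof (intro sum_mono overlap)
    fix a a' assume *: "a \<in> A" "a' \<in> A - {a}"
    then have c: "a \<in> carrier G" "a' \<in> carrier G" using assms by auto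
    then show "inv a' \<otimes> a \<in> carrier G" by simp
    show "inv a' \<otimes> a \<noteq> \<one>"
    proof
      assume "inv a' \<otimes> a = \<one>"
      then have "a = a'" using c by (metis inv_equality inv_closed inv_inv)
      then show False using * by simp
    qed
  qed
  also have "\<dots> = card A * (card A - 1) * k"
    using assms by simp
  finally show ?thesis
    using six_excess_le_collisions[of "A \<times> B" "\<lambda>(a, b). a \<otimes> b"] assms by simp
qed

lemma right_stabilizer_subgroup:
  assumes "B \<subseteq> carrier G"
  shows "subgroup {h \<in> carrier G. (\<lambda>b. b \<otimes> h) ` B = B} G"
proof (rule subgroupI)
  show "{h \<in> carrier G. (\<lambda>b. b \<otimes> h) ` B = B} \<noteq> {}"
    using assms by (auto intro!: exI[of _ \<one>] simp: image_iff subset_iff)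
next
  fix h assume h: "h \<in> {h \<in> carrier G. (\<lambda>b. b \<otimes> h) ` B = B}"
  then have "(\<lambda>b. b \<otimes> inv h) ` (\<lambda>b. b \<otimes> h) ` B = B"
    using assms unfolding image_image by (auto simp: m_assoc subset_iff image_iff)
  then show "inv h \<in> {h \<in> carrier G. (\<lambda>b. b \<otimes> h) ` B = B}" using h by auto
next
  fix h k assume hk: "h \<in> {h \<in> carrier G. (\<lambda>b. b \<otimes> h) ` B = B}" "k \<in> {h \<in> carrier G. (\<lambda>b. b \<otimes> h) ` B = B}"
  have "(\<lambda>b. b \<otimes> (h \<otimes> k)) ` B = (\<lambda>b. b \<otimes> k) ` (\<lambda>b. b \<otimes> h) ` B"
    unfolding image_image using assms hk by (intro image_cong) (auto simp: m_assoc subset_iff)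
  then show "h \<otimes> k \<in> {h \<in> carrier G. (\<lambda>b. b \<otimes> h) ` B = B}" using hk by auto
qed auto

text \<open>The ratio c / e plays the role of \<theta>. Writing it as a fraction makes the functional that is
  maximized below integer valued, so that boundedness alone makes the maximum exist. The
  hypothesis on subgroups says |L| / (|L| - 2) \<le> c / e; as the left side decreases with |L|,
  it only has to be known for a smallest L.\<close>

lemma product_excess_bound:
  fixes c e :: nat
  assumes ce: "e \<le> c"
    and sub: "\<And>L. subgroup L G \<Longrightarrow> finite L \<Longrightarrow> card L \<ge> 3 \<Longrightarrow> e * card L \<le> c * (card L - 2)"
    and "A \<subseteq> carrier G" "B \<subseteq> carrier G" "finite A" "finite B" "card A \<ge> 2" "card B \<ge> 2"
  shows "e * product_excess A B \<le> c * ((card A - 2) * (card B - 2))"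
  using assms(3-)
proof (induction "card A" arbitrary: A B rule: less_induct)
  case (less A B0)
  note A = less.prems(1,3,5)
  define n where "n = card A"
  have n2: "n \<ge> 2" using A by (simp add: n_def)
  show ?case
  proof (rule ccontr)
    assume counter: "\<not> ?thesis"
    define adm where "adm B \<longleftrightarrow> B \<subseteq> carrier G \<and> finite B \<and> card B \<ge> 2" for B
    define F where "F B = int (e * product_excess A B) - int (c * (n - 2)) * (int (card B) - 2)" for B
    have F_eq: "F B = int (e * product_excess A B) - int (c * ((n - 2) * (card B - 2)))"
      if "card B \<ge> 2" for B
      using that by (simp only: F_def of_nat_mult of_nat_diff of_nat_numeral mult.assoc)
    have B0: "adm B0" using less.prems by (simp add: adm_def)
    have F0: "F B0 > 0"
    proof -
      have "int (e * product_excess A B0) > int (c * ((n - 2) * (card B0 - 2)))"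
        using counter by (simp only: n_def of_nat_less_iff not_le)
      then show ?thesis using F_eq[OF less.prems(6)] by simp
    qed
    \<comment> \<open>The bound is independent of B because e \<le> c makes the coefficient of |B| nonpositive.\<close>
    have F_le: "F B \<le> int (2 * c * (n - 2))" if "adm B" for B
    proof -
      have "e * product_excess A B \<le> c * ((n - 2) * card B)"
        using product_excess_le[of A B] that A ce unfolding adm_def n_def by (intro mult_le_mono) auto
      then have "int (e * product_excess A B) \<le> int (c * (n - 2)) * int (card B)"
        by (simp only: of_nat_mult[symmetric] of_nat_le_iff mult.assoc)
      moreover have "int (2 * c * (n - 2)) = int (c * (n - 2)) * 2" by simp
      ultimately show ?thesis unfolding F_def right_diff_distrib by linarith
    qed
    \<comment> \<open>The set B is chosen to maximize F and, among the maximizers, to have the fewest elements.\<close>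
    define \<mu> where "\<mu> B = nat (int (2 * c * (n - 2)) - F B)" for B
    have "B0 \<in> Collect adm" using B0 by simp
    from wfE_min[OF wf_measures[of "[\<mu>, card]"] this]
    obtain B where "B \<in> Collect adm"
      and min: "\<And>C. (C, B) \<in> measures [\<mu>, card] \<Longrightarrow> C \<notin> Collect adm" by blast
    then have admB: "adm B" by simp
    have not_smaller: "\<not> \<mu> C < \<mu> B \<and> \<not> (\<mu> C = \<mu> B \<and> card C < card B)" if "adm C" for C
      using min[of C] that by auto
    have F_max: "F C \<le> F B" if "adm C" for C
      using not_smaller[OF that] F_le[OF that] F_le[OF admB] unfolding \<mu>_def by linarith
    have F_min: "F C < F B" if "adm C" "card C < card B" for C
      using not_smaller[OF that(1)] that(2) F_le[OF that(1)] F_le[OF admB] unfolding \<mu>_def by linarith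
    have FB: "F B > 0" using F0 F_max[OF B0] by simp
    have B: "B \<subseteq> carrier G" "finite B" "card B \<ge> 2" using admB by (auto simp: adm_def)
    define m where "m = card B"
    have large: "e * product_excess A B > c * ((n - 2) * (m - 2))"
    proof -
      have "int (c * ((n - 2) * (m - 2))) < int (e * product_excess A B)"
        using FB F_eq[OF B(3)] by (simp add: m_def)
      then show ?thesis by (simp only: of_nat_less_iff)
    qed
    have n3: "n \<ge> 3"
    proof (rule ccontr)
      assume "\<not> ?thesis"
      then have "card A = 2" using n2 n_def by simp
      then show False using large product_excess_le[of A B] A B by simp
    qed
    \<comment> \<open>Otherwise the induction hypothesis applies to the inverses of B and A in this order.\<close>
    have mn: "m \<ge> n"
    proof (rule ccontr)
      assume "\<not> ?thesis"
      then have lt: "card (m_inv G ` B) < card A"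
        using inv_image_set[OF B(1)] by (simp add: m_def n_def)
      have "e * product_excess (m_inv G ` B) (m_inv G ` A)
          \<le> c * ((card (m_inv G ` B) - 2) * (card (m_inv G ` A) - 2))"
        by (rule less.hyps[OF lt]) (use inv_image_set A B in auto)
      then show False
        using large inv_image_set[OF B(1)] inv_image_set[OF A(1)] product_excess_inv[OF A(1) B(1)]
        by (simp add: m_def n_def mult_ac)
    qed
    \<comment> \<open>The atom property: supermodularity against the extremal choice of B.\<close>
    have atom: "card (B \<inter> (\<lambda>b. b \<otimes> h) ` B) \<le> 1"
      if h: "h \<in> carrier G" and ne: "(\<lambda>b. b \<otimes> h) ` B \<noteq> B" for h
    proof (rule ccontr)
      let ?C = "(\<lambda>b. b \<otimes> h) ` B"
      assume two: "\<not> ?thesis"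
      have C: "?C \<subseteq> carrier G" "finite ?C" "card ?C = card B"
        using B h by (auto intro!: card_image inj_onI simp: subset_iff)
      have "\<not> B \<subseteq> ?C" using ne C card_subset_eq[of ?C B] by auto
      then have "card (B \<inter> ?C) < card B" using B(2) by (intro psubset_card_mono) auto
      moreover have "adm (B \<inter> ?C)" using B two by (auto simp: adm_def)
      ultimately have lt: "F (B \<inter> ?C) < F B" using F_min by blast
      have "card B \<le> card (B \<union> ?C)" using B C by (intro card_mono) auto
      then have "adm (B \<union> ?C)" using B C by (auto simp: adm_def)
      then have le: "F (B \<union> ?C) \<le> F B" by (rule F_max)
      have ex: "product_excess A ?C = product_excess A B"
        by (rule product_excess_translate[OF A(1) B(1) h])
      have "A \<times> (B \<inter> ?C) = A \<times> B \<inter> A \<times> ?C" "A \<times> (B \<union> ?C) = A \<times> B \<union> A \<times> ?C" by auto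
      then have "product_excess A B + product_excess A B
          \<le> product_excess A (B \<inter> ?C) + product_excess A (B \<union> ?C)"
        using excess_supermodular[of "A \<times> B" "A \<times> ?C" "\<lambda>(a, b). a \<otimes> b"] A B C ex by simp
      then have "e * (product_excess A B + product_excess A B)
          \<le> e * (product_excess A (B \<inter> ?C) + product_excess A (B \<union> ?C))"
        by (rule mult_le_mono2)
      then have sup: "int (e * product_excess A B) + int (e * product_excess A B)
          \<le> int (e * product_excess A (B \<inter> ?C)) + int (e * product_excess A (B \<union> ?C))"
        by (simp only: distrib_left of_nat_add[symmetric] of_nat_le_iff)
      have inter: "int (card (B \<inter> ?C)) = int (card B) + int (card B) - int (card (B \<union> ?C))"
        using card_Un_Int[OF B(2) C(2)] C(3) by simp
      have "F B + F B \<le> F (B \<inter> ?C) + F (B \<union> ?C)"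
        unfolding F_def inter right_diff_distrib distrib_left using sup by linarith
      then show False using lt le by simp
    qed
    define H where "H = {h \<in> carrier G. (\<lambda>b. b \<otimes> h) ` B = B}"
    have H: "subgroup H G" unfolding H_def by (rule right_stabilizer_subgroup[OF B(1)])
    have HG: "H \<subseteq> carrier G" by (auto simp: H_def)
    have coset: "(\<lambda>h. b \<otimes> h) ` H \<subseteq> B" if "b \<in> B" for b
      using that by (auto simp: H_def)
    have inj: "inj_on (\<lambda>h. b \<otimes> h) H" if "b \<in> B" for b
      using that B HG by (auto simp: inj_on_def subset_iff)
    obtain b0 where b0: "b0 \<in> B" using B(3) by fastforce
    have finH: "finite H" using inj[OF b0] coset[OF b0] B(2) by (metis finite_imageD finite_subset)
    have card_coset: "card ((\<lambda>h. b \<otimes> h) ` H) = card H" if "b \<in> B" for b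
      using inj[OF that] by (rule card_image)
    have Hm: "card H \<le> m" using coset[OF b0] card_coset[OF b0] B(2) by (metis card_mono m_def)
    \<comment> \<open>A larger stabilizer makes B so large that the bound S \<le> (n - 2) m suffices.\<close>
    have H2: "card H \<le> 2"
    proof (rule ccontr)
      assume "\<not> ?thesis"
      then have "e * card H \<le> c * (card H - 2)" and H3: "card H \<ge> 3" using sub[OF H finH] by auto
      moreover have "e * (m - card H) \<le> c * (m - card H)" using ce by simp
      ultimately have "e * (card H + (m - card H)) \<le> c * (card H - 2 + (m - card H))"
        unfolding distrib_left by linarith
      moreover have "card H + (m - card H) = m" "card H - 2 + (m - card H) = m - 2"
        using Hm H3 by auto
      ultimately have "e * m \<le> c * (m - 2)" by simp
      then have "e * ((n - 2) * m) \<le> c * ((n - 2) * (m - 2))"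
        using mult_le_mono2[of "e * m" "c * (m - 2)" "n - 2"] by (simp only: mult_ac)
      moreover have "e * product_excess A B \<le> e * ((n - 2) * m)"
        unfolding n_def m_def by (intro mult_le_mono2 product_excess_le A B)
      ultimately show False using large by linarith
    qed
    \<comment> \<open>B is a union of left cosets of H, and it is too large to be a single one.\<close>
    have m2H: "2 * card H \<le> m"
    proof -
      have "\<not> B \<subseteq> (\<lambda>h. b0 \<otimes> h) ` H"
      proof
        assume "B \<subseteq> (\<lambda>h. b0 \<otimes> h) ` H"
        then have "m \<le> card H" using card_coset[OF b0] finH by (metis card_mono finite_imageI m_def)
        then show False using H2 n3 mn by simp
      qed
      then obtain b1 where b1: "b1 \<in> B" "b1 \<notin> (\<lambda>h. b0 \<otimes> h) ` H" by blast
      have "(\<lambda>h. b0 \<otimes> h) ` H \<inter> (\<lambda>h. b1 \<otimes> h) ` H = {}"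
      proof (rule ccontr)
        assume "\<not> ?thesis"
        then obtain h k where hk: "h \<in> H" "k \<in> H" "b0 \<otimes> h = b1 \<otimes> k" by auto
        have car: "h \<in> carrier G" "k \<in> carrier G" "b0 \<in> carrier G" "b1 \<in> carrier G"
          using hk HG b0 b1 B by auto
        have "b1 = b0 \<otimes> h \<otimes> inv k" using hk(3) car by (simp add: inv_solve_right)
        then have "b1 = b0 \<otimes> (h \<otimes> inv k)" using car by (simp add: m_assoc)
        moreover have "h \<otimes> inv k \<in> H" using H hk by (simp add: subgroup.m_closed subgroup.m_inv_closed)
        ultimately show False using b1 by blast
      qed
      then have "card ((\<lambda>h. b0 \<otimes> h) ` H \<union> (\<lambda>h. b1 \<otimes> h) ` H) = 2 * card H"
        using finH card_coset b0 b1 by (simp add: card_Un_disjoint)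
      moreover have "(\<lambda>h. b0 \<otimes> h) ` H \<union> (\<lambda>h. b1 \<otimes> h) ` H \<subseteq> B" using coset b0 b1 by blast
      ultimately show ?thesis using B(2) by (metis card_mono m_def)
    qed
    \<comment> \<open>The atom property concerns right translates. It carries over to left translates: if
      b1, b2, g b1, g b2 all lie in B, then right translation by k = inv b1 b2 sends b1 to b2 and
      g b1 to g b2, so B and B k share two points and k stabilizes B.\<close>
    have overlap: "card {b \<in> B. g \<otimes> b \<in> B} \<le> card H" if g: "g \<in> carrier G" "g \<noteq> \<one>" for g
    proof (cases "{b \<in> B. g \<otimes> b \<in> B} = {}")
      case False
      then obtain b1 where b1: "b1 \<in> B" "g \<otimes> b1 \<in> B" by blast
      have "{b \<in> B. g \<otimes> b \<in> B} \<subseteq> (\<lambda>h. b1 \<otimes> h) ` H"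
      proof
        fix b2 assume "b2 \<in> {b \<in> B. g \<otimes> b \<in> B}"
        then have b2: "b2 \<in> B" "g \<otimes> b2 \<in> B" by auto
        have car: "b1 \<in> carrier G" "b2 \<in> carrier G" using b1 b2 B by auto
        define k where "k = inv b1 \<otimes> b2"
        have k: "k \<in> carrier G" "b1 \<otimes> k = b2" "(g \<otimes> b1) \<otimes> k = g \<otimes> b2"
          using car g by (auto simp: k_def m_assoc inv_solve_left[symmetric] simp flip: m_assoc)
        have "b2 \<in> (\<lambda>b. b \<otimes> k) ` B" "g \<otimes> b2 \<in> (\<lambda>b. b \<otimes> k) ` B"
          using imageI[OF b1(1), of "\<lambda>b. b \<otimes> k"] imageI[OF b1(2), of "\<lambda>b. b \<otimes> k"]
          unfolding k by blast+
        then have "{b2, g \<otimes> b2} \<subseteq> B \<inter> (\<lambda>b. b \<otimes> k) ` B"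
          using b2 by simp
        then have "card {b2, g \<otimes> b2} \<le> card (B \<inter> (\<lambda>b. b \<otimes> k) ` B)"
          using B by (intro card_mono) auto
        moreover have "g \<otimes> b2 \<noteq> b2" using g car by simp
        ultimately have "\<not> card (B \<inter> (\<lambda>b. b \<otimes> k) ` B) \<le> 1" by auto
        then have "k \<in> H" using atom[OF k(1)] k(1) by (auto simp: H_def)
        then show "b2 \<in> (\<lambda>h. b1 \<otimes> h) ` H" using k(2) by blast
      qed
      then show ?thesis using card_coset[OF b1(1)] finH by (metis card_mono finite_imageI)
    next
      case True
      show ?thesis unfolding True by simp
    qed
    have "6 * product_excess A B \<le> n * (n - 1) * card H"
      unfolding n_def by (rule six_product_excess_le) (use A B overlap in auto)
    also have "\<dots> \<le> 6 * ((n - 2) * (m - 2))"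
      by (rule few_collisions_estimate[OF n3 mn m2H H2])
    finally have "product_excess A B \<le> (n - 2) * (m - 2)" by simp
    then have "e * product_excess A B \<le> c * ((n - 2) * (m - 2))"
      using ce by (intro mult_le_mono)
    then show False using large by linarith
  qed
qed

lemma product_excess_le_theta:
  assumes "A \<subseteq> carrier G" "B \<subseteq> carrier G" "finite A" "finite B" "card A \<ge> 2" "card B \<ge> 2"
  shows "real (product_excess A B)
    \<le> theta (ereal_of_enat (alpha3 G)) * (real (card A) - 2) * (real (card B) - 2)"
proof -
  have alpha: "alpha3 G \<le> enat (card L)" if "subgroup L G" "finite L" "card L \<ge> 3" for L
    unfolding alpha3_def
  proof (rule Inf_lower)
    show "enat (card L) \<in> {ext_card L |L. subgroup L G \<and> 3 \<le> ext_card L}"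
      using that by (auto intro!: exI[of _ L] simp: ext_card_def numeral_eq_enat)
  qed
  have three: "3 \<le> alpha3 G" unfolding alpha3_def by (rule Inf_greatest) auto
  show ?thesis
  proof (cases "alpha3 G")
    case infinity
    then have "1 * product_excess A B \<le> 1 * ((card A - 2) * (card B - 2))"
      using alpha by (intro product_excess_bound assms) auto
    then have "real (product_excess A B) \<le> real ((card A - 2) * (card B - 2))"
      by (simp only: of_nat_le_iff mult_1)
    then show ?thesis using assms infinity by (simp add: theta_def of_nat_diff)
  next
    case (enat p)
    then have p3: "p \<ge> 3" using three by (simp add: numeral_eq_enat)
    have "(p - 2) * product_excess A B \<le> p * ((card A - 2) * (card B - 2))"
    proof (rule product_excess_bound)
      fix L assume "subgroup L G" "finite L" "card L \<ge> 3"
      then have "p \<le> card L" using alpha enat by simp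
      then show "(p - 2) * card L \<le> p * (card L - 2)"
        by (simp add: diff_mult_distrib diff_mult_distrib2)
    qed (use assms in auto)
    then have "real ((p - 2) * product_excess A B) \<le> real (p * ((card A - 2) * (card B - 2)))"
      by (simp only: of_nat_le_iff)
    then have "(real p - 2) * real (product_excess A B)
        \<le> real p * ((real (card A) - 2) * (real (card B) - 2))"
      using p3 assms by (simp add: of_nat_diff)
    then have "real (product_excess A B)
        \<le> real p / (real p - 2) * ((real (card A) - 2) * (real (card B) - 2))"
      using p3 by (simp add: pos_le_divide_eq mult.commute)
    moreover have "theta (ereal_of_enat (alpha3 G)) = real p / (real p - 2)"
      using enat by (simp add: theta_def)
    ultimately show ?thesis by (simp only: mult.assoc)
  qed
qed

end

section \<open>Single-product and single-quotient families\<close>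

theorem corollary3p5:
  fixes G :: "('a, 'm) monoid_scheme" and A B :: "'a set"
  assumes "group G"
    and "A \<subseteq> carrier G" and "B \<subseteq> carrier G"
    and "finite A" and "finite B"
    and "card A \<ge> 2" and "card B \<ge> 2"
  shows "(\<forall>\<E>. disjoint \<E> \<and> (\<forall>E\<in>\<E>. single_product_subset G A B E) \<longrightarrow>
            (\<Sum>E\<in>\<E>. real (card E) - 2)
              \<le> theta (ereal_of_enat (alpha3 G)) * (real (card A) - 2) * (real (card B) - 2))
       \<and> (\<forall>\<C>. disjoint \<C> \<and> (\<forall>C\<in>\<C>. single_quotient_subset G A B C) \<longrightarrow>
            (\<Sum>C\<in>\<C>. real (card C) - 2)
              \<le> theta (ereal_of_enat (alpha3 G)) * (real (card A) - 2) * (real (card B) - 2))"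
proof -
  interpret group G by fact
  have fam: "(\<Sum>E\<in>\<E>. real (card E) - 2) \<le> real (excess (\<lambda>(a, b). f a b) (A \<times> B))"
    if "disjoint \<E>" and E: "\<And>E. E \<in> \<E> \<Longrightarrow> E \<subseteq> A \<times> B \<and> card {f a b | a b. (a, b) \<in> E} = 1"
    for \<E> and f :: "'a \<Rightarrow> 'a \<Rightarrow> 'a"
  proof (rule sum_card_minus_2_le_excess)
    fix D assume "D \<in> \<E>"
    then obtain x where "{f a b | a b. (a, b) \<in> D} = {x}" using E by (meson card_1_singletonE)
    moreover have "(\<lambda>(a, b). f a b) ` D = {f a b | a b. (a, b) \<in> D}" by force
    ultimately show "\<exists>x. (\<lambda>(a, b). f a b) ` D = {x}" by auto
  qed (use that assms in auto)
  have "excess (\<lambda>(a, b). a \<otimes>\<^bsub>G\<^esub> inv\<^bsub>G\<^esub> b) (A \<times> B) = product_excess A (m_inv G ` B)"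
  proof (rule excess_reindex[where g = id, symmetric])
    show "bij_betw (\<lambda>(a, b). (a, inv\<^bsub>G\<^esub> b)) (A \<times> B) (A \<times> m_inv G ` B)"
      using assms by (auto simp: bij_betw_def inj_on_def image_iff) (metis inv_inv subsetD)
  qed auto
  then have quot: "real (excess (\<lambda>(a, b). a \<otimes>\<^bsub>G\<^esub> inv\<^bsub>G\<^esub> b) (A \<times> B))
      \<le> theta (ereal_of_enat (alpha3 G)) * (real (card A) - 2) * (real (card B) - 2)"
    using product_excess_le_theta[of A "m_inv G ` B"] inv_image_set[of B] assms by simp
  show ?thesis
  proof (intro conjI allI impI; elim conjE)
    fix \<E> assume "disjoint \<E>" "\<forall>E\<in>\<E>. single_product_subset G A B E"
    then have "(\<Sum>E\<in>\<E>. real (card E) - 2) \<le> real (product_excess A B)"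
      by (intro fam) (auto simp: single_product_subset_def)
    then show "(\<Sum>E\<in>\<E>. real (card E) - 2)
        \<le> theta (ereal_of_enat (alpha3 G)) * (real (card A) - 2) * (real (card B) - 2)"
      using product_excess_le_theta[of A B] assms by linarith
  next
    fix \<C> assume "disjoint \<C>" "\<forall>C\<in>\<C>. single_quotient_subset G A B C"
    then have "(\<Sum>C\<in>\<C>. real (card C) - 2)
        \<le> real (excess (\<lambda>(a, b). a \<otimes>\<^bsub>G\<^esub> inv\<^bsub>G\<^esub> b) (A \<times> B))"
      by (intro fam) (auto simp: single_quotient_subset_def)
    then show "(\<Sum>C\<in>\<C>. real (card C) - 2)
        \<le> theta (ereal_of_enat (alpha3 G)) * (real (card A) - 2) * (real (card B) - 2)"
      using quot by linarith
  qed
qed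

end
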